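(* Let $G$ be a finite group, let $N$ be a characteristic subgroup of $G$, let $x\in G$ and $\alpha\in\mathrm{Aut}(G)$, and let $A=\mathrm{A}_{x,\alpha}$. Denote by $\tilde{A}$ the affine map of $G/N$ induced by $A$. Then there exists a subset $M\subseteq N$ such that \[\mathrm{ord}(A)=\mathrm{ord}(\tilde{A})\cdot\operatorname{lcm}_{m\in M}\mathrm{ord}\bigl(\mathrm{A}_{m,(\alpha_{\mid N})^{\mathrm{ord}(\tilde{A})}}\bigr).\]
   Context: For a group $H$, $y\in H$ and $\beta\in\mathrm{Aut}(H)$, $\mathrm{A}_{y,\beta}:H\rightarrow H$ denotes the bijective affine map $h\mapsto y\beta(h)$, and $\mathrm{ord}(\mathrm{A}_{y,\beta})$ is its order as a permutation of $H$. The induced map $\tilde{A}$ on $G/N$ is $gN\mapsto A(g)N$, i.e. $\tilde{A}=\mathrm{A}_{xN,\tilde{\alpha}}$ where $\tilde{\alpha}$ is the automorphism of $G/N$ induced by $\alpha$. $\alpha_{\mid N}$ is the restriction of $\alpha$ to $N$, an automorphism of $N$; for $m\in N$, the map $\mathrm{A}_{m,(\alpha_{\mid N})^{k}}$ is a bijective affine map of $N$. *)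

theory Defs
  imports "HOL-Algebra.Bij" "HOL-Algebra.Multiplicative_Group"
begin

definition characteristic_subgroup :: "'a set \<Rightarrow> ('a, 'b) monoid_scheme \<Rightarrow> bool" where
  "characteristic_subgroup N G \<longleftrightarrow> subgroup N G \<and> (\<forall>\<phi>\<in>auto G. \<phi> ` N = N)"

text \<open>
  As in \<^theory>\<open>HOL-Algebra.Bij\<close>, permutations and automorphisms are represented by extensional
  functions, so that they are elements of \<^const>\<open>BijGroup\<close> and \<^const>\<open>AutoGroup\<close>.
\<close>

definition affine_map :: "('a, 'b) monoid_scheme \<Rightarrow> 'a \<Rightarrow> ('a \<Rightarrow> 'a) \<Rightarrow> 'a \<Rightarrow> 'a" where
  "affine_map H y \<beta> = (\<lambda>h\<in>carrier H. y \<otimes>\<^bsub>H\<^esub> \<beta> h)"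

abbreviation perm_ord :: "'a set \<Rightarrow> ('a \<Rightarrow> 'a) \<Rightarrow> nat" where
  "perm_ord S f \<equiv> group.ord (BijGroup S) f"

text \<open>
  The map \<open>g N \<mapsto> f(g) N\<close>, meaningful when \<open>f(g) N\<close> depends only on the coset of \<open>g\<close>. The elements
  of \<open>G Mod N\<close> are formally right cosets, which are the left cosets when \<open>N\<close> is normal; see
  \<open>induced_map_affine\<close> and \<open>induced_map_affine_eq\<close> below.
\<close>

definition induced_map ::
    "('a, 'b) monoid_scheme \<Rightarrow> 'a set \<Rightarrow> ('a \<Rightarrow> 'a) \<Rightarrow> 'a set \<Rightarrow> 'a set" where
  "induced_map G N f = (\<lambda>C\<in>carrier (G Mod N). THE D. \<forall>g\<in>C. D = f g <#\<^bsub>G\<^esub> N)"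

lemma auto_memD:
  assumes "\<phi> \<in> auto G"
  shows "\<phi> ` carrier G = carrier G" and "inj_on \<phi> (carrier G)"
    and "x \<in> carrier G \<Longrightarrow> \<phi> x \<in> carrier G"
    and "\<lbrakk>x \<in> carrier G; y \<in> carrier G\<rbrakk> \<Longrightarrow> \<phi> (x \<otimes>\<^bsub>G\<^esub> y) = \<phi> x \<otimes>\<^bsub>G\<^esub> \<phi> y"
  using assms by (auto simp: auto_def Bij_def bij_betw_def hom_def)

context group
begin

lemma conj_in_auto:
  assumes "a \<in> carrier G"
  shows "(\<lambda>g\<in>carrier G. a \<otimes> g \<otimes> inv a) \<in> auto G"
proof -
  have c: "inv a \<otimes> (a \<otimes> g) = g" "a \<otimes> (inv a \<otimes> g) = g" if "g \<in> carrier G" for g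
    using assms that by (simp_all add: m_assoc[symmetric])
  have "bij_betw (\<lambda>g. a \<otimes> g \<otimes> inv a) (carrier G) (carrier G)"
    by (rule bij_betw_byWitness[where f' = "\<lambda>g. inv a \<otimes> g \<otimes> a"])
      (use assms in \<open>auto simp: m_assoc c\<close>)
  moreover have "a \<otimes> (x \<otimes> y) \<otimes> inv a = (a \<otimes> x \<otimes> inv a) \<otimes> (a \<otimes> y \<otimes> inv a)"
    if "x \<in> carrier G" "y \<in> carrier G" for x y
    using assms that by (simp add: m_assoc c)
  ultimately show ?thesis
    using assms by (auto simp: auto_def Bij_def hom_def cong: bij_betw_cong)
qed

lemma characteristic_imp_normal:
  assumes "characteristic_subgroup N G"
  shows "N \<lhd> G"
proof -
  have N: "subgroup N G" using assms by (simp add: characteristic_subgroup_def)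
  have "a \<otimes> h \<otimes> inv a \<in> N" if a: "a \<in> carrier G" and h: "h \<in> N" for a h
  proof -
    have "(\<lambda>g\<in>carrier G. a \<otimes> g \<otimes> inv a) ` N = N"
      using assms conj_in_auto[OF a] unfolding characteristic_subgroup_def by blast
    moreover have "h \<in> carrier G" using subgroup.subset[OF N] h by blast
    ultimately show ?thesis using h by (metis imageI restrict_apply)
  qed
  then show ?thesis using N normal_inv_iff by blast
qed

lemma restrict_auto_characteristic:
  assumes "characteristic_subgroup N G" "\<alpha> \<in> auto G"
  shows "restrict \<alpha> N \<in> auto (G\<lparr>carrier := N\<rparr>)"
proof -
  have N: "N \<subseteq> carrier G" and S: "subgroup N G"
    using assms(1) subgroup.subset by (auto simp: characteristic_subgroup_def)
  have im: "\<alpha> ` N = N" using assms by (simp add: characteristic_subgroup_def)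
  have "bij_betw (restrict \<alpha> N) N N"
    using im inj_on_subset[OF auto_memD(2)[OF assms(2)] N]
    by (simp add: bij_betw_def inj_on_def)
  moreover have "restrict \<alpha> N (x \<otimes> y) = restrict \<alpha> N x \<otimes> restrict \<alpha> N y"
    if "x \<in> N" "y \<in> N" for x y
    using that auto_memD(4)[OF assms(2) subsetD[OF N] subsetD[OF N]] subgroup.m_closed[OF S]
    by simp
  ultimately show ?thesis using im
    by (auto simp: auto_def Bij_def hom_def)
qed

lemma affine_map_Bij:
  assumes "y \<in> carrier G" "\<beta> \<in> auto G"
  shows "affine_map G y \<beta> \<in> Bij (carrier G)"
proof -
  have "inj_on (\<lambda>h. y \<otimes> \<beta> h) (carrier G)"
    using assms auto_memD[OF assms(2)] by (auto simp: inj_on_def)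
  moreover have "(\<lambda>h. y \<otimes> \<beta> h) ` carrier G = carrier G"
  proof -
    have "(\<lambda>h. y \<otimes> \<beta> h) ` carrier G = (\<lambda>h. y \<otimes> h) ` carrier G"
      using auto_memD(1)[OF assms(2)] by (metis image_image)
    then show ?thesis using assms(1) surj_const_mult by simp
  qed
  ultimately show ?thesis
    by (auto simp: affine_map_def Bij_def bij_betw_def)
qed

lemma induced_map_affine:
  assumes "characteristic_subgroup N G" "x \<in> carrier G" "\<alpha> \<in> auto G" "g \<in> carrier G"
  shows "induced_map G N (affine_map G x \<alpha>) (g <# N) = affine_map G x \<alpha> g <# N"
proof -
  interpret N: normal N G using assms(1) by (rule characteristic_imp_normal)
  have im: "\<alpha> ` N = N" using assms by (simp add: characteristic_subgroup_def)
  have eq: "affine_map G x \<alpha> g' <# N = affine_map G x \<alpha> g <# N" if "g' \<in> g <# N" for g'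
  proof -
    obtain n where n: "n \<in> N" "g' = g \<otimes> n" using \<open>g' \<in> g <# N\<close> unfolding l_coset_def by blast
    then have nc: "n \<in> carrier G" by simp
    have an: "\<alpha> n \<in> N" using im n by blast
    have e: "affine_map G x \<alpha> g' = affine_map G x \<alpha> g \<otimes> \<alpha> n"
      using n nc assms an auto_memD[OF assms(3)] by (simp add: affine_map_def m_assoc)
    have A: "affine_map G x \<alpha> g \<in> carrier G"
      using assms auto_memD(3)[OF assms(3)] by (simp add: affine_map_def)
    have "\<alpha> n <# N = N" using an by (intro coset_join3) (auto intro: N.subgroup_axioms)
    then show ?thesis unfolding e using lcos_m_assoc[OF N.subset A N.mem_carrier[OF an]] by simp
  qed
  have "g \<otimes> \<one> \<in> g <# N" unfolding l_coset_def using N.one_closed by blast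
  then have self: "g \<in> g <# N" using assms(4) by simp
  have "(THE D. \<forall>g'\<in>g <# N. D = affine_map G x \<alpha> g' <# N) = affine_map G x \<alpha> g <# N"
    by (rule the_equality) (use eq self in blast)+
  moreover have "g <# N \<in> carrier (G Mod N)"
    using rcosetsI[OF N.subset assms(4)] bspec[OF N.coset_eq assms(4)] by (simp add: FactGroup_def)
  ultimately show ?thesis by (simp add: induced_map_def)
qed

lemma induced_map_affine_eq:
  assumes "characteristic_subgroup N G" "x \<in> carrier G" "\<alpha> \<in> auto G"
  shows "induced_map G N (affine_map G x \<alpha>) = affine_map (G Mod N) (x <# N) (induced_map G N \<alpha>)"
proof
  interpret N: normal N G using assms(1) by (rule characteristic_imp_normal)
  have "\<alpha> \<in> extensional (carrier G)" using assms(3) by (simp add: auto_def Bij_def)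
  then have \<alpha>: "affine_map G \<one> \<alpha> = \<alpha>"
    unfolding affine_map_def using auto_memD(3)[OF assms(3)]
    by (intro extensionalityI[of _ "carrier G"]) auto
  fix C
  show "induced_map G N (affine_map G x \<alpha>) C = affine_map (G Mod N) (x <# N) (induced_map G N \<alpha>) C"
  proof (cases "C \<in> carrier (G Mod N)")
    case True
    then obtain g where "g \<in> carrier G" "C = N #> g"
      by (auto simp: FactGroup_def RCOSETS_def)
    then have g: "g \<in> carrier G" "C = g <# N" using N.coset_eq by blast+
    have ag: "\<alpha> g \<in> carrier G" using auto_memD(3)[OF assms(3)] g by blast
    have "induced_map G N \<alpha> C = \<alpha> g <# N"
      using induced_map_affine[OF assms(1) one_closed assms(3) g(1)] g(2) by (simp add: \<alpha>)
    moreover have "(x <# N) <#> (\<alpha> g <# N) = (x \<otimes> \<alpha> g) <# N"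
      using N.rcos_sum[OF assms(2) ag] bspec[OF N.coset_eq assms(2)] bspec[OF N.coset_eq ag]
        bspec[OF N.coset_eq m_closed[OF assms(2) ag]] by (simp only:)
    moreover have "induced_map G N (affine_map G x \<alpha>) C = (x \<otimes> \<alpha> g) <# N"
      using induced_map_affine[OF assms g(1)] g by (simp add: affine_map_def)
    ultimately show ?thesis using True by (simp add: affine_map_def FactGroup_def)
  next
    case False
    then show ?thesis by (simp add: induced_map_def affine_map_def)
  qed
qed

end

end

theory Submission
  imports Defs
begin

text \<open>
  With \<open>k\<close> the order of the induced map, \<open>A\<^sup>k\<close> maps each coset \<open>g N\<close> to itself, so
  \<open>m\<^sub>g = g\<^sup>-\<^sup>1 A\<^sup>k(g)\<close> lies in \<open>N\<close>. Identifying \<open>N\<close> with \<open>g N\<close> by \<open>n \<mapsto> g n\<close> turns the action of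
  \<open>A\<^sup>k\<close> on that coset into the affine map \<open>n \<mapsto> m\<^sub>g \<alpha>\<^sup>k(n)\<close>. Hence the order of \<open>A\<^sup>k\<close> is the least
  common multiple of the orders of these maps, and \<open>M = {m\<^sub>g | g \<in> G}\<close> works.
\<close>

lemma funpow_closed:
  assumes "f ` S \<subseteq> S" "s \<in> S"
  shows "(f ^^ n) s \<in> S"
  using assms by (induction n) auto

lemma carrier_BijGroup: "carrier (BijGroup S) = Bij S"
  by (simp add: BijGroup_def)

lemma one_BijGroup: "\<one>\<^bsub>BijGroup S\<^esub> = (\<lambda>s\<in>S. s)"
  by (simp add: BijGroup_def)

lemma mult_BijGroup_apply:
  assumes "f \<in> Bij S" "g \<in> Bij S" "s \<in> S"
  shows "(f \<otimes>\<^bsub>BijGroup S\<^esub> g) s = f (g s)"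
  using assms by (simp add: BijGroup_def compose_def)

text \<open>Pointwise on \<open>S\<close> only: elements of \<open>BijGroup S\<close> are
  extensional, so their powers and \<open>f ^^ n\<close> may differ outside
  \<open>S\<close>.\<close>

lemma BijGroup_pow_apply:
  assumes "f \<in> Bij S" "s \<in> S"
  shows "(f [^]\<^bsub>BijGroup S\<^esub> (n::nat)) s = (f ^^ n) s"
  using assms(2)
proof (induction n arbitrary: s)
  case 0
  then show ?case by (simp add: one_BijGroup)
next
  case (Suc n)
  interpret B: group "BijGroup S" by (rule group_BijGroup)
  have "f [^]\<^bsub>BijGroup S\<^esub> n \<in> Bij S"
    using B.nat_pow_closed[of f n] assms(1) by (simp add: carrier_BijGroup)
  moreover have "f s \<in> S"
    using assms(1) Suc.prems by (auto simp: Bij_def bij_betw_def)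
  moreover have "(f ^^ n) (f s) = f ((f ^^ n) s)"
    by (rule funpow_swap1[symmetric])
  ultimately show ?case
    using Suc assms(1) by (simp add: mult_BijGroup_apply)
qed

text \<open>All three orders in the theorem are reached only through this criterion, which turns
  statements about \<open>ord\<close> into statements about fixed points of iterates.\<close>

lemma perm_ord_dvd_iff:
  assumes "f \<in> Bij S"
  shows "perm_ord S f dvd n \<longleftrightarrow> (\<forall>s\<in>S. (f ^^ n) s = s)"
proof -
  interpret B: group "BijGroup S" by (rule group_BijGroup)
  have f: "f \<in> carrier (BijGroup S)" using assms by (simp add: carrier_BijGroup)
  have p: "f [^]\<^bsub>BijGroup S\<^esub> n \<in> extensional S"
    using B.nat_pow_closed[OF f, of n] unfolding carrier_BijGroup by (simp add: Bij_def)
  have "perm_ord S f dvd n \<longleftrightarrow> f [^]\<^bsub>BijGroup S\<^esub> n = (\<lambda>s\<in>S. s)"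
    using B.pow_eq_id[OF f, of n] unfolding one_BijGroup by simp
  also have "\<dots> \<longleftrightarrow> (\<forall>s\<in>S. (f ^^ n) s = s)"
  proof
    assume "f [^]\<^bsub>BijGroup S\<^esub> n = (\<lambda>s\<in>S. s)"
    then show "\<forall>s\<in>S. (f ^^ n) s = s"
      using BijGroup_pow_apply[OF assms, of _ n] by (metis restrict_apply')
  next
    assume "\<forall>s\<in>S. (f ^^ n) s = s"
    then show "f [^]\<^bsub>BijGroup S\<^esub> n = (\<lambda>s\<in>S. s)"
      using p BijGroup_pow_apply[OF assms] by (intro extensionalityI[of _ S]) auto
  qed
  finally show ?thesis .
qed

lemma AutoGroup_pow_apply:
  assumes "group H" "\<beta> \<in> auto H" "h \<in> carrier H"
  shows "(\<beta> [^]\<^bsub>AutoGroup H\<^esub> (n::nat)) h = (\<beta> ^^ n) h"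
proof -
  \<comment> \<open>\<open>AutoGroup H\<close> differs from \<open>BijGroup (carrier H)\<close> only
    in its carrier, and \<open>nat_pow\<close> looks only at multiplication and unit.\<close>
  have "\<beta> [^]\<^bsub>AutoGroup H\<^esub> n = \<beta> [^]\<^bsub>BijGroup (carrier H)\<^esub> n"
    by (simp add: AutoGroup_def nat_pow_def)
  then show ?thesis
    using BijGroup_pow_apply[of \<beta> "carrier H"] assms by (simp add: auto_def)
qed

lemma AutoGroup_pow_closed:
  assumes "group H" "\<beta> \<in> auto H"
  shows "\<beta> [^]\<^bsub>AutoGroup H\<^esub> (n::nat) \<in> auto H"
proof -
  interpret Aut: group "AutoGroup H" using assms(1) by (rule group.AutoGroup)
  show ?thesis using Aut.nat_pow_closed[of \<beta> n] assms(2) by (simp add: AutoGroup_def)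
qed

lemma (in group) l_coset_eq_imp_diff_mem:
  assumes "subgroup N G" "g \<in> carrier G" "h \<in> carrier G" "g <# N = h <# N"
  shows "inv g \<otimes> h \<in> N"
proof -
  interpret N: subgroup N G by fact
  have "h \<otimes> \<one> \<in> h <# N" unfolding l_coset_def using N.one_closed by blast
  then have "h \<in> g <# N" using assms by simp
  then obtain n where n: "n \<in> N" "h = g \<otimes> n" unfolding l_coset_def by blast
  then have "inv g \<otimes> h = n" using assms by (simp add: m_assoc[symmetric])
  then show ?thesis using n by simp
qed

context
  fixes G :: "('a, 'b) monoid_scheme" (structure) and N x \<alpha>
  assumes G: "group G" and char: "characteristic_subgroup N G"
    and x: "x \<in> carrier G" and \<alpha>: "\<alpha> \<in> auto G"
begin

interpretation group G by (rule G)

interpretation N: normal N G using char by (rule characteristic_imp_normal)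

lemma affine_map_funpow_closed:
  assumes "g \<in> carrier G"
  shows "(affine_map G x \<alpha> ^^ n) g \<in> carrier G"
  using assms x auto_memD(3)[OF \<alpha>] by (intro funpow_closed) (auto simp: affine_map_def)

lemma auto_funpow_closed:
  assumes "g \<in> carrier G"
  shows "(\<alpha> ^^ n) g \<in> carrier G"
  using assms auto_memD(3)[OF \<alpha>] by (intro funpow_closed) auto

text \<open>The translation by \<open>x\<close> is absorbed by the left factor, so the right factor
  sees only the automorphism. This is what makes an iterate that preserves a coset of
  \<open>N\<close> act there as an affine map of \<open>N\<close>.\<close>

lemma affine_map_funpow_mult:
  assumes "g \<in> carrier G" "h \<in> carrier G"
  shows "(affine_map G x \<alpha> ^^ n) (g \<otimes> h) = (affine_map G x \<alpha> ^^ n) g \<otimes> (\<alpha> ^^ n) h"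
proof (induction n)
  case (Suc n)
  have "affine_map G x \<alpha> (a \<otimes> b) = affine_map G x \<alpha> a \<otimes> \<alpha> b"
    if "a \<in> carrier G" "b \<in> carrier G" for a b
    using that auto_memD(3,4)[OF \<alpha>] x by (simp add: affine_map_def m_assoc)
  then show ?case
    using Suc affine_map_funpow_closed[OF assms(1)] auto_funpow_closed[OF assms(2)] by simp
qed simp

lemma induced_map_funpow:
  assumes "g \<in> carrier G"
  shows "(induced_map G N (affine_map G x \<alpha>) ^^ n) (g <# N) = (affine_map G x \<alpha> ^^ n) g <# N"
  by (induction n)
    (simp_all add: induced_map_affine[OF char x \<alpha>] affine_map_funpow_closed assms)

lemma carrier_FactGroup_l_cosets: "carrier (G Mod N) = (\<lambda>g. g <# N) ` carrier G"
  using N.coset_eq by (auto simp: FactGroup_def RCOSETS_def)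

text \<open>Surjectivity descends from the affine map. Injectivity rests on \<alpha> mapping
  \<open>N\<close> onto itself, so that elements outside \<open>N\<close> stay outside.\<close>

lemma induced_map_Bij: "induced_map G N (affine_map G x \<alpha>) \<in> Bij (carrier (G Mod N))"
proof -
  let ?A = "affine_map G x \<alpha>" and ?A' = "induced_map G N (affine_map G x \<alpha>)"
  have A: "?A ` carrier G = carrier G"
    using affine_map_Bij[OF x \<alpha>] by (auto simp: Bij_def bij_betw_def)
  have Ac: "?A g \<in> carrier G" if "g \<in> carrier G" for g
    using A that by blast
  have A': "?A' (g <# N) = ?A g <# N" if "g \<in> carrier G" for g
    using induced_map_affine[OF char x \<alpha> that] .
  have "?A' ` carrier (G Mod N) = (\<lambda>g. g <# N) ` ?A ` carrier G"
    unfolding carrier_FactGroup_l_cosets image_image using A' by (intro image_cong) auto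
  then have surj: "?A' ` carrier (G Mod N) = carrier (G Mod N)"
    by (simp add: A carrier_FactGroup_l_cosets)
  have inj: "g <# N = h <# N"
    if g: "g \<in> carrier G" and h: "h \<in> carrier G" and eq: "?A g <# N = ?A h <# N" for g h
  proof -
    define d where "d = inv g \<otimes> h"
    have d: "d \<in> carrier G" and hd: "h = g \<otimes> d"
      using g h by (simp_all add: d_def m_assoc[symmetric])
    have "?A h = ?A g \<otimes> \<alpha> d"
      using affine_map_funpow_mult[OF g d, of 1] hd by simp
    then have "inv ?A g \<otimes> ?A h = \<alpha> d"
      using Ac[OF g] auto_memD(3)[OF \<alpha> d] by (simp add: m_assoc[symmetric])
    \<comment> \<open>Writing \<open>N\<close> as its own image lets injectivity of \<alpha> pull
      the membership back to \<open>d\<close>.\<close>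
    then have "\<alpha> d \<in> \<alpha> ` N"
      using l_coset_eq_imp_diff_mem[OF N.subgroup_axioms Ac[OF g] Ac[OF h] eq] char \<alpha>
      by (simp add: characteristic_subgroup_def)
    then have "d \<in> N"
      using inj_on_image_mem_iff[OF auto_memD(2)[OF \<alpha>] d N.subset] by simp
    then have "d <# N = N" using d by (intro coset_join3 N.subgroup_axioms)
    then show ?thesis using lcos_m_assoc[OF N.subset g d] hd by simp
  qed
  have "inj_on ?A' (carrier (G Mod N))"
    unfolding carrier_FactGroup_l_cosets
  proof (rule inj_onI, elim imageE)
    fix C D g h
    assume "?A' C = ?A' D" "C = g <# N" "D = h <# N" "g \<in> carrier G" "h \<in> carrier G"
    then show "C = D" using inj[of g h] by (simp only: A')
  qed
  then show ?thesis using surj by (simp add: Bij_def bij_betw_def induced_map_def)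
qed

lemma perm_ord_affine_map:
  defines "A \<equiv> affine_map G x \<alpha>"
  defines "k \<equiv> perm_ord (carrier (G Mod N)) (induced_map G N A)"
  shows "\<exists>M\<subseteq>N. perm_ord (carrier G) A =
    k * (LCM m\<in>M. perm_ord N
      (affine_map (G\<lparr>carrier := N\<rparr>) m (restrict \<alpha> N [^]\<^bsub>AutoGroup (G\<lparr>carrier := N\<rparr>)\<^esub> k)))"
proof -
  define \<beta> where "\<beta> = restrict \<alpha> N [^]\<^bsub>AutoGroup (G\<lparr>carrier := N\<rparr>)\<^esub> k"
  define m where "m g = inv g \<otimes> (A ^^ k) g" for g
  define B where "B g = affine_map (G\<lparr>carrier := N\<rparr>) (m g) \<beta>" for g
  \<comment> \<open>Indexed by group elements for now; the passage to a subset of \<open>N\<close>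
    comes at the end.\<close>
  define L where "L = (LCM g\<in>carrier G. perm_ord N (B g))"
  interpret H: group "G\<lparr>carrier := N\<rparr>" by (rule N.subgroup_is_group[OF G])
  have \<alpha>N: "restrict \<alpha> N \<in> auto (G\<lparr>carrier := N\<rparr>)"
    by (rule restrict_auto_characteristic[OF char \<alpha>])
  have \<beta>: "\<beta> \<in> auto (G\<lparr>carrier := N\<rparr>)"
    unfolding \<beta>_def by (rule AutoGroup_pow_closed[OF H.is_group \<alpha>N])
  have \<beta>_apply: "\<beta> n = (\<alpha> ^^ k) n" if n: "n \<in> N" for n
  proof -
    have "\<alpha> ` N = N" using char \<alpha> by (simp add: characteristic_subgroup_def)
    \<comment> \<open>Membership in \<open>N\<close> is carried through the induction because
      \<open>restrict \<alpha> N\<close> agrees with \<alpha> only there.\<close>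
    then have "(restrict \<alpha> N ^^ i) n = (\<alpha> ^^ i) n \<and> (\<alpha> ^^ i) n \<in> N" for i
      using n by (induction i) auto
    then show ?thesis
      using AutoGroup_pow_apply[OF H.is_group \<alpha>N, of n k] n by (simp add: \<beta>_def)
  qed
  have Ak: "(A ^^ i) g \<in> carrier G" if "g \<in> carrier G" for g i
    unfolding A_def by (rule affine_map_funpow_closed[OF that])
  \<comment> \<open>Used twice: \<open>i = k\<close> puts \<open>m g\<close> into \<open>N\<close>,
    and \<open>i\<close> the order of \<open>A\<close> gives that \<open>k\<close> divides this
    order.\<close>
  have A'_dvd: "k dvd i \<longleftrightarrow> (\<forall>g\<in>carrier G. (A ^^ i) g <# N = g <# N)" for i
    unfolding k_def A_def perm_ord_dvd_iff[OF induced_map_Bij]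
    by (simp add: carrier_FactGroup_l_cosets induced_map_funpow)
  have mN: "m g \<in> N" if g: "g \<in> carrier G" for g
  proof -
    have "g <# N = (A ^^ k) g <# N" using A'_dvd[of k] g by simp
    then show ?thesis
      unfolding m_def by (rule l_coset_eq_imp_diff_mem[OF N.subgroup_axioms g Ak[OF g]])
  qed
  have BBij: "B g \<in> Bij N" if "g \<in> carrier G" for g
    using H.affine_map_Bij[OF _ \<beta>, of "m g"] mN[OF that] by (simp add: B_def)
  have conj: "(A ^^ (k * j)) (g \<otimes> n) = g \<otimes> (B g ^^ j) n" and BN: "(B g ^^ j) n \<in> N"
    if g: "g \<in> carrier G" and n: "n \<in> N" for g n j
  proof -
    have BN: "(B g ^^ i) n \<in> N" for i
      using BBij[OF g] n by (intro funpow_closed) (auto simp: Bij_def bij_betw_def)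
    have step: "(A ^^ k) (g \<otimes> n') = g \<otimes> B g n'" if n': "n' \<in> N" for n'
    proof -
      have "(A ^^ k) (g \<otimes> n') = (A ^^ k) g \<otimes> \<beta> n'"
        using affine_map_funpow_mult[OF g N.mem_carrier[OF n'], of k] \<beta>_apply[OF n']
        by (simp add: A_def)
      also have "\<dots> = g \<otimes> m g \<otimes> \<beta> n'"
        using g Ak[OF g] by (simp add: m_def m_assoc[symmetric])
      also have "\<dots> = g \<otimes> B g n'"
        using g n' mN[OF g] auto_memD(3)[OF \<beta>, of n'] by (simp add: B_def affine_map_def m_assoc)
      finally show ?thesis .
    qed
    show "(A ^^ (k * j)) (g \<otimes> n) = g \<otimes> (B g ^^ j) n"
      \<comment> \<open>The exponent \<open>k * Suc j\<close> splits as \<open>k + k * j\<close>, so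
        one more application of \<open>A ^^ k\<close> meets \<open>step\<close> at the point
        \<open>(B g ^^ j) n\<close> of \<open>N\<close>.\<close>
      by (induction j) (simp_all add: funpow_add step BN)
    show "(B g ^^ j) n \<in> N" by (rule BN)
  qed
  have L_dvd: "perm_ord (carrier G) A dvd k * j \<longleftrightarrow> L dvd j" for j
  proof -
    have "L dvd j \<longleftrightarrow> (\<forall>g\<in>carrier G. \<forall>n\<in>N. (B g ^^ j) n = n)"
      by (simp add: L_def Lcm_dvd_iff perm_ord_dvd_iff[OF BBij])
    also have "\<dots> \<longleftrightarrow> (\<forall>g\<in>carrier G. \<forall>n\<in>N. (A ^^ (k * j)) (g \<otimes> n) = g \<otimes> n)"
      by (simp add: conj BN)
    \<comment> \<open>Every \<open>g\<close> lies in its own coset: take \<open>n\<close> to be the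
      unit. Conversely each product \<open>g \<otimes> n\<close> is itself an element of the
      group.\<close>
    also have "\<dots> \<longleftrightarrow> (\<forall>g\<in>carrier G. (A ^^ (k * j)) g = g)"
    proof (intro iffI ballI)
      fix g assume "\<forall>g\<in>carrier G. \<forall>n\<in>N. (A ^^ (k * j)) (g \<otimes> n) = g \<otimes> n" "g \<in> carrier G"
      then show "(A ^^ (k * j)) g = g" using N.one_closed r_one by fastforce
    qed simp
    finally show ?thesis
      using perm_ord_dvd_iff[OF affine_map_Bij[OF x \<alpha>]] by (simp add: A_def)
  qed
  have "k dvd perm_ord (carrier G) A"
    using perm_ord_dvd_iff[OF affine_map_Bij[OF x \<alpha>], of "perm_ord (carrier G) A"]
    by (simp add: A'_dvd A_def)
  then obtain l where l: "perm_ord (carrier G) A = k * l" by blast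
  \<comment> \<open>The choices \<open>l\<close> and \<open>L\<close> for \<open>j\<close> in
    \<open>L_dvd\<close> give the two divisibilities between \<open>k * l\<close> and
    \<open>k * L\<close>.\<close>
  then have "L dvd l" using L_dvd[of l] by simp
  moreover have "k * l dvd k * L" using L_dvd[of L] l by simp
  ultimately have "perm_ord (carrier G) A = k * L"
    using l by (auto intro: dvd_antisym)
  \<comment> \<open>\<open>B g\<close> depends on \<open>g\<close> only through \<open>m g\<close>,
    so the index set can be replaced by the image of \<open>m\<close>, the required witness.\<close>
  moreover have "L = (LCM m\<in>m ` carrier G. perm_ord N (affine_map (G\<lparr>carrier := N\<rparr>) m \<beta>))"
    by (simp add: L_def B_def image_image)
  moreover have "m ` carrier G \<subseteq> N" using mN by blast
  ultimately show ?thesis unfolding \<beta>_def by (intro exI[of _ "m ` carrier G"] conjI) simp_all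
qed

end

theorem proposition1p1p1:
  fixes G :: "('a, 'b) monoid_scheme" and N :: "'a set" and x :: 'a and \<alpha> :: "'a \<Rightarrow> 'a"
  assumes "group G" and "finite (carrier G)"
    and "characteristic_subgroup N G"
    and "x \<in> carrier G" and "\<alpha> \<in> auto G"
  defines "A \<equiv> affine_map G x \<alpha>"
  defines "A' \<equiv> induced_map G N A"
  defines "k \<equiv> perm_ord (carrier (G Mod N)) A'"
  shows "\<exists>M\<subseteq>N. perm_ord (carrier G) A =
    k * (LCM m\<in>M. perm_ord N
      (affine_map (G\<lparr>carrier := N\<rparr>) m (restrict \<alpha> N [^]\<^bsub>AutoGroup (G\<lparr>carrier := N\<rparr>)\<^esub> k)))"
  unfolding k_def A'_def A_def by (rule perm_ord_affine_map[OF assms(1,3,4,5)])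

end
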